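(* If a graph $G$ has a $1$-queue layout, then $\operatorname{mag}(G)=|V(G)|$.
   Context: Graphs are finite, simple and undirected. A vertex ordering of $G$ is a bijection $\sigma:V(G)\to\{1,\dots,|V(G)|\}$. Two edges $vw,xy$ with no common endpoint, labelled so that $\sigma(v)<\sigma(w)$, $\sigma(x)<\sigma(y)$ and $\sigma(v)<\sigma(x)$, are nested in $\sigma$ if $\sigma(v)<\sigma(x)<\sigma(y)<\sigma(w)$. A queue in $\sigma$ is a set of edges no two of which are nested in $\sigma$. A $k$-queue layout of $G$ consists of a vertex ordering $\sigma$ of $G$ and a partition of $E(G)$ into $k$ queues in $\sigma$; in particular a $1$-queue layout is a vertex ordering in which no two edges of $G$ are nested. An injection $f:V(G)\to\mathbb{Z}^+$ is antimagic if $f(v)+f(w)\neq f(x)+f(y)$ for all distinct edges $vw,xy\in E(G)$. With $[k]=\{1,\dots,k\}$, $\operatorname{mag}(G)$ is the minimum $k$ such that $G$ has an antimagic injection $V(G)\to[k]$. *)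

theory Defs
  imports Main "HOL-Library.Disjoint_Sets"
begin

definition simple_graph :: "'a set \<Rightarrow> 'a set set \<Rightarrow> bool" where
  "simple_graph V E \<longleftrightarrow> finite V \<and> (\<forall>e\<in>E. e \<subseteq> V \<and> card e = 2)"

definition vertex_ordering :: "'a set \<Rightarrow> ('a \<Rightarrow> nat) \<Rightarrow> bool" where
  "vertex_ordering V \<sigma> \<longleftrightarrow> bij_betw \<sigma> V {1..card V}"

text \<open>Nestedness is a symmetric relation: the edge containing the leftmost of the four
  endpoints may be either of the two.\<close>

definition nested :: "('a \<Rightarrow> nat) \<Rightarrow> 'a set \<Rightarrow> 'a set \<Rightarrow> bool" where
  "nested \<sigma> e e' \<longleftrightarrow> e \<inter> e' = {} \<and>
     (\<exists>v w x y. {e, e'} = {{v, w}, {x, y}} \<and> \<sigma> v < \<sigma> x \<and> \<sigma> x < \<sigma> y \<and> \<sigma> y < \<sigma> w)"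

definition is_queue :: "('a \<Rightarrow> nat) \<Rightarrow> 'a set set \<Rightarrow> bool" where
  "is_queue \<sigma> Q \<longleftrightarrow> (\<forall>e\<in>Q. \<forall>e'\<in>Q. \<not> nested \<sigma> e e')"

text \<open>The parts of the partition are indexed and may be empty, so that an edgeless graph has a
  \<open>k\<close>-queue layout for every \<open>k\<close>.\<close>

definition queue_layout ::
    "nat \<Rightarrow> 'a set \<Rightarrow> 'a set set \<Rightarrow> ('a \<Rightarrow> nat) \<Rightarrow> (nat \<Rightarrow> 'a set set) \<Rightarrow> bool" where
  "queue_layout k V E \<sigma> Q \<longleftrightarrow>
     vertex_ordering V \<sigma> \<and>
     disjoint_family_on Q {1..k} \<and> (\<Union>i\<in>{1..k}. Q i) = E \<and>
     (\<forall>i\<in>{1..k}. is_queue \<sigma> (Q i))"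

definition antimagic :: "'a set \<Rightarrow> 'a set set \<Rightarrow> ('a \<Rightarrow> nat) \<Rightarrow> bool" where
  "antimagic V E f \<longleftrightarrow>
     inj_on f V \<and> (\<forall>v\<in>V. f v > 0) \<and>
     (\<forall>v w x y. {v, w} \<in> E \<longrightarrow> {x, y} \<in> E \<longrightarrow> {v, w} \<noteq> {x, y} \<longrightarrow> f v + f w \<noteq> f x + f y)"

text \<open>The minimum exists for every finite graph, since distinct powers of two form an antimagic
  injection.\<close>

definition mag :: "'a set \<Rightarrow> 'a set set \<Rightarrow> nat" where
  "mag V E = (LEAST k. \<exists>f. antimagic V E f \<and> f ` V \<subseteq> {1..k})"

end

theory Submission
  imports Defs
begin

text \<open>The vertex ordering of a one-queue layout is itself antimagic: two distinct edges with equal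
  label sums cannot share an endpoint, and the edge with the smaller minimum label then has the
  larger maximum label, so the two edges are nested.\<close>

text \<open>The labels increase strictly along \<open>v\<close>, \<open>x\<close>, \<open>y\<close>,
  \<open>w\<close>, so the strict inequalities also give the disjointness that \<open>nested\<close>
  demands.\<close>

lemma nested_of_sum_eq:
  assumes "\<sigma> v < \<sigma> x" "\<sigma> x < \<sigma> y" "\<sigma> v + \<sigma> w = \<sigma> x + \<sigma> y"
  shows "nested \<sigma> {v, w} {x, y}"
proof -
  have "\<sigma> y < \<sigma> w"
    using assms by linarith
  moreover from this have "{v, w} \<inter> {x, y} = {}"
    using assms by auto
  ultimately show ?thesis
    using assms unfolding nested_def by blast
qed

text \<open>As an equivalence, this lets the simplifier rewrite the sum condition of
  \<open>antimagic\<close> into a triviality.\<close>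

lemma queue_sum_eq_iff:
  assumes inj: "inj_on \<sigma> V" and queue: "is_queue \<sigma> E" and graph: "simple_graph V E"
    and "{v, w} \<in> E" "{x, y} \<in> E"
  shows "\<sigma> v + \<sigma> w = \<sigma> x + \<sigma> y \<longleftrightarrow> {v, w} = {x, y}"
proof
  assume sum: "\<sigma> v + \<sigma> w = \<sigma> x + \<sigma> y"
  have ordered: "{a, b} = {c, d}"
    if "{a, b} \<in> E" "{c, d} \<in> E" "\<sigma> a < \<sigma> b" "\<sigma> c < \<sigma> d" "\<sigma> a + \<sigma> b = \<sigma> c + \<sigma> d" for a b c d
  proof -
    have "\<not> nested \<sigma> {a, b} {c, d}" "\<not> nested \<sigma> {c, d} {a, b}"
      using queue that by (auto simp: is_queue_def)
    \<comment> \<open>If the minima differed, the edge with the smaller one would enclose the other;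
      each order contradicts one of the two facts above.\<close>
    then have "\<sigma> a = \<sigma> c"
      using that nested_of_sum_eq[of \<sigma> a c d b] nested_of_sum_eq[of \<sigma> c a b d]
      by (metis nat_neq_iff)
    moreover have "a \<in> V" "b \<in> V" "c \<in> V" "d \<in> V"
      using graph that by (auto simp: simple_graph_def)
    moreover from calculation have "\<sigma> b = \<sigma> d"
      using that by simp
    ultimately have "a = c" "b = d"
      using inj by (auto dest: inj_onD)
    then show ?thesis
      by simp
  qed
  \<comment> \<open>Edges are not loops, so each can be written with its smaller label first, as
    \<open>ordered\<close> requires.\<close>
  have endpoints_neq: "\<sigma> a \<noteq> \<sigma> b" if "{a, b} \<in> E" for a b
  proof -
    have "a \<in> V" "b \<in> V" "card {a, b} = 2"
      using graph that by (auto simp: simple_graph_def)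
    moreover from this have "a \<noteq> b"
      by (metis card_2_iff doubleton_eq_iff)
    ultimately show ?thesis
      using inj inj_on_eq_iff by metis
  qed
  consider "\<sigma> v < \<sigma> w" | "\<sigma> w < \<sigma> v"
    using endpoints_neq assms(4) by (meson nat_neq_iff)
  then obtain a b where ab: "{v, w} = {a, b}" "\<sigma> a < \<sigma> b" "\<sigma> v + \<sigma> w = \<sigma> a + \<sigma> b"
    using that[of v w] that[of w v] by cases (simp_all add: insert_commute)
  consider "\<sigma> x < \<sigma> y" | "\<sigma> y < \<sigma> x"
    using endpoints_neq assms(5) by (meson nat_neq_iff)
  then obtain c d where cd: "{x, y} = {c, d}" "\<sigma> c < \<sigma> d" "\<sigma> x + \<sigma> y = \<sigma> c + \<sigma> d"
    using that[of x y] that[of y x] by cases (simp_all add: insert_commute)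
  show "{v, w} = {x, y}"
    using ordered[of a b c d] ab cd sum assms(4,5) by simp
next
  assume "{v, w} = {x, y}"
  then show "\<sigma> v + \<sigma> w = \<sigma> x + \<sigma> y"
    by (auto simp: doubleton_eq_iff)
qed

theorem lemma9:
  fixes V :: "'a set" and E :: "'a set set"
  assumes "simple_graph V E"
    and "\<exists>\<sigma> Q. queue_layout 1 V E \<sigma> Q"
  shows "mag V E = card V"
proof -
  \<comment> \<open>For k = 1 the only part of the partition is \<open>E\<close> itself.\<close>
  obtain \<sigma> where bij: "bij_betw \<sigma> V {1..card V}" and queue: "is_queue \<sigma> E"
    using assms(2) by (auto simp: queue_layout_def vertex_ordering_def)
  have inj: "inj_on \<sigma> V" and image: "\<sigma> ` V = {1..card V}"
    using bij by (auto simp: bij_betw_def)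
  have "\<forall>v\<in>V. \<sigma> v > 0"
    using image by fastforce
  then have "antimagic V E \<sigma>"
    using inj queue_sum_eq_iff[OF inj queue assms(1)] by (simp add: antimagic_def)
  then have "\<exists>f. antimagic V E f \<and> f ` V \<subseteq> {1..card V}"
    using image by blast
  \<comment> \<open>The lower bound is pure counting: an injection of \<open>V\<close> into
    \<open>{1..k}\<close> needs at least \<open>card V\<close> labels.\<close>
  moreover have "card V \<le> k" if "\<exists>f. antimagic V E f \<and> f ` V \<subseteq> {1..k}" for k
    using that card_inj_on_le[of _ V "{1..k}"] by (auto simp: antimagic_def)
  ultimately show ?thesis
    unfolding mag_def by (rule Least_equality)
qed

end
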